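(* Let $t\geq 1$ and let $m\geq 3$ be odd. Let $G$ be isomorphic to $D_{2^{t+1}m}$ or $Q_{2^{t+1}m}$, and let $\Gamma=\mathcal{E}_c^-(G)$. Then $\mathrm{Spec}(\Gamma)=\{(0)^{m(2^t-1)},(-2^t)^{m-1},(2^t(m-1))^1\}$, $\mathrm{L\text{-}spec}(\Gamma)=\{(0)^1,(2^t(m-1))^{m(2^t-1)},(2^tm)^{m-1}\}$, $\mathrm{Q\text{-}spec}(\Gamma)=\{(2^t(m-1))^{m(2^t-1)},(2^t(m-2))^{m-1},(2^{t+1}(m-1))^1\}$, and $E(\Gamma)=LE(\Gamma)=LE^+(\Gamma)=2^{t+1}(m-1)$.
   Context: For elements $x,y$ of a group, $[x,y]=x^{-1}y^{-1}xy$, $[x,{}_1y]=[x,y]$ and $[x,{}_{k+1}y]=[[x,{}_ky],y]$ for $k\ge 1$. For a finite group $G$ with Fitting subgroup $F(G)$, $\mathcal{E}_c^-(G)$ is the simple undirected graph with vertex set $G\setminus F(G)$ in which distinct $x,y$ are adjacent iff $[x,{}_ky]\neq 1$ and $[y,{}_kx]\neq 1$ for all positive integers $k$. $D_{2n}$ is the dihedral group of order $2n$; $Q_{2^{t+1}m}=\langle x,y\mid y^{2^tm}=1,\ x^2=y^{2^{t-1}m},\ xyx^{-1}=y^{-1}\rangle$ (order $2^{t+1}m$). For a finite simple graph $\Gamma$ with vertex set $v(\Gamma)$, edge set $e(\Gamma)$, adjacency matrix $A$ and degree matrix $D$: $\mathrm{Spec}(\Gamma)$, $\mathrm{L\text{-}spec}(\Gamma)$,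 $\mathrm{Q\text{-}spec}(\Gamma)$ are the multisets of eigenvalues of $A$, $D-A$, $D+A$ respectively; in $\{(\alpha_1)^{n_1},\dots,(\alpha_k)^{n_k}\}$ the exponent $n_i$ is the multiplicity of $\alpha_i$. $E(\Gamma)=\sum_{\lambda\in \mathrm{Spec}(\Gamma)}|\lambda|$, $LE(\Gamma)=\sum_{\mu\in \mathrm{L\text{-}spec}(\Gamma)}\left|\mu-\frac{2|e(\Gamma)|}{|v(\Gamma)|}\right|$, $LE^+(\Gamma)=\sum_{\nu\in \mathrm{Q\text{-}spec}(\Gamma)}\left|\nu-\frac{2|e(\Gamma)|}{|v(\Gamma)|}\right|$, sums being with multiplicity. *)

theory Defs
  imports
    "HOL-Algebra.Generated_Groups"
    "HOL-Library.Multiset"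
    "Jordan_Normal_Form.Char_Poly"
begin

section \<open>Commutators, nilpotency, Fitting subgroup\<close>

text \<open>The convention is $[x,y] = x^{-1}y^{-1}xy$, which is not the one used for
  \<^const>\<open>derived_set\<close>.\<close>

definition commutator :: "('a, 'b) monoid_scheme \<Rightarrow> 'a \<Rightarrow> 'a \<Rightarrow> 'a" where
  "commutator G x y = inv\<^bsub>G\<^esub> x \<otimes>\<^bsub>G\<^esub> inv\<^bsub>G\<^esub> y \<otimes>\<^bsub>G\<^esub> x \<otimes>\<^bsub>G\<^esub> y"

text \<open>\<open>engel_commutator G x y k\<close> is $[x,{}_k y]$. The recursion starts at \<open>k = 0\<close> with \<open>x\<close>,
  so that the value at \<open>k = 1\<close> is $[x,y]$.\<close>

primrec engel_commutator :: "('a, 'b) monoid_scheme \<Rightarrow> 'a \<Rightarrow> 'a \<Rightarrow> nat \<Rightarrow> 'a" where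
  "engel_commutator G x y 0 = x"
| "engel_commutator G x y (Suc k) = commutator G (engel_commutator G x y k) y"

primrec lower_central :: "('a, 'b) monoid_scheme \<Rightarrow> nat \<Rightarrow> 'a set" where
  "lower_central G 0 = carrier G"
| "lower_central G (Suc n) =
     generate G {commutator G x y | x y. x \<in> lower_central G n \<and> y \<in> carrier G}"

definition nilpotent_group :: "('a, 'b) monoid_scheme \<Rightarrow> bool" where
  "nilpotent_group G \<longleftrightarrow> group G \<and> (\<exists>n. lower_central G n = {\<one>\<^bsub>G\<^esub>})"

text \<open>The subgroup generated by all nilpotent normal subgroups; for a finite group this is the
  largest nilpotent normal subgroup.\<close>

definition fitting_subgroup :: "('a, 'b) monoid_scheme \<Rightarrow> 'a set" where
  "fitting_subgroup G = generate G (\<Union>{N. N \<lhd> G \<and> nilpotent_group (G\<lparr>carrier := N\<rparr>)})"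


section \<open>Groups given by generators and relations\<close>

text \<open>Words over the generators \<open>'g\<close> and their formal inverses: \<open>(g, True)\<close> stands for \<open>g\<close> and
  \<open>(g, False)\<close> for the inverse of \<open>g\<close>. A relator pair \<open>(r, s) \<in> R\<close> stands for the relation
  \<open>r = s\<close>; \<open>pres_eq R\<close> is equality of words in the group presented by \<open>R\<close>. All elements of the
  type \<open>'g\<close> are generators.\<close>

type_synonym 'g word = "('g \<times> bool) list"

inductive pres_eq :: "('g word \<times> 'g word) set \<Rightarrow> 'g word \<Rightarrow> 'g word \<Rightarrow> bool"
  for R :: "('g word \<times> 'g word) set" where
  refl: "pres_eq R u u"
| sym: "pres_eq R u v \<Longrightarrow> pres_eq R v u"
| trans: "pres_eq R u v \<Longrightarrow> pres_eq R v w \<Longrightarrow> pres_eq R u w"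
| cancel: "pres_eq R (u @ [(g, b), (g, \<not> b)] @ v) (u @ v)"
| rel: "(r, s) \<in> R \<Longrightarrow> pres_eq R (u @ r @ v) (u @ s @ v)"

definition pres_class :: "('g word \<times> 'g word) set \<Rightarrow> 'g word \<Rightarrow> 'g word set" where
  "pres_class R u = {v. pres_eq R u v}"

definition presented_group :: "('g word \<times> 'g word) set \<Rightarrow> 'g word set monoid" where
  "presented_group R =
     \<lparr>carrier = range (pres_class R),
      monoid.mult = (\<lambda>A B. {w. \<exists>u\<in>A. \<exists>v\<in>B. pres_eq R (u @ v) w}),
      one = pres_class R []\<rparr>"

lemma pres_eq_append_left: "pres_eq R u v \<Longrightarrow> pres_eq R (a @ u) (a @ v)"
proof (induction rule: pres_eq.induct)
  case (cancel u g b v)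
  then show ?case using pres_eq.cancel[of R "a @ u" g b v] by simp
next
  case (rel r s u v)
  then show ?case using pres_eq.rel[of r s R "a @ u" v] by simp
qed (auto intro: pres_eq.refl pres_eq.sym pres_eq.trans)

lemma pres_eq_append_right: "pres_eq R u v \<Longrightarrow> pres_eq R (u @ a) (v @ a)"
proof (induction rule: pres_eq.induct)
  case (cancel u g b v)
  then show ?case using pres_eq.cancel[of R u g b "v @ a"] by simp
next
  case (rel r s u v)
  then show ?case using pres_eq.rel[of r s R u "v @ a"] by simp
qed (auto intro: pres_eq.refl pres_eq.sym pres_eq.trans)

lemma pres_eq_append:
  "pres_eq R u u' \<Longrightarrow> pres_eq R v v' \<Longrightarrow> pres_eq R (u @ v) (u' @ v')"
  by (blast intro: pres_eq.trans pres_eq_append_left pres_eq_append_right)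

lemma pres_class_eq_iff: "pres_class R u = pres_class R v \<longleftrightarrow> pres_eq R u v"
  unfolding pres_class_def by (blast intro: pres_eq.refl pres_eq.sym pres_eq.trans)

lemma presented_group_mult:
  "pres_class R u \<otimes>\<^bsub>presented_group R\<^esub> pres_class R v = pres_class R (u @ v)"
  unfolding presented_group_def pres_class_def
  by (auto intro: pres_eq.refl pres_eq.trans pres_eq_append)

lemma pres_eq_word_inverse:
  "pres_eq R (rev (map (\<lambda>(g, b). (g, \<not> b)) w) @ w) []"
proof (induction w)
  case Nil
  show ?case by (simp add: pres_eq.refl)
next
  case (Cons a w)
  obtain g b where a: "a = (g, b)" by fastforce
  let ?i = "rev (map (\<lambda>(g, b). (g, \<not> b)) w)"
  have "pres_eq R (?i @ [(g, \<not> b), (g, \<not> \<not> b)] @ w) (?i @ w)"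
    by (rule pres_eq.cancel)
  then show ?case using Cons a by (auto intro: pres_eq.trans)
qed

lemma group_presented_group: "group (presented_group R)"
proof (rule groupI)
  note [simp] = presented_group_mult
  have carr: "carrier (presented_group R) = range (pres_class R)"
    and one: "\<one>\<^bsub>presented_group R\<^esub> = pres_class R []"
    by (simp_all add: presented_group_def)
  show "\<one>\<^bsub>presented_group R\<^esub> \<in> carrier (presented_group R)"
    by (simp add: carr one)
  fix x y z
  assume x: "x \<in> carrier (presented_group R)"
  then obtain u where u: "x = pres_class R u" by (auto simp: carr)
  show "\<one>\<^bsub>presented_group R\<^esub> \<otimes>\<^bsub>presented_group R\<^esub> x = x"
    by (simp add: u one)
  have "pres_class R (rev (map (\<lambda>(g, b). (g, \<not> b)) u)) \<otimes>\<^bsub>presented_group R\<^esub> x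
      = \<one>\<^bsub>presented_group R\<^esub>"
    by (simp add: u one pres_class_eq_iff pres_eq_word_inverse)
  then show "\<exists>y\<in>carrier (presented_group R). y \<otimes>\<^bsub>presented_group R\<^esub> x = \<one>\<^bsub>presented_group R\<^esub>"
    by (auto simp: carr)
  assume y: "y \<in> carrier (presented_group R)"
  then show "x \<otimes>\<^bsub>presented_group R\<^esub> y \<in> carrier (presented_group R)"
    by (auto simp: carr u)
  assume z: "z \<in> carrier (presented_group R)"
  then show "x \<otimes>\<^bsub>presented_group R\<^esub> y \<otimes>\<^bsub>presented_group R\<^esub> z
      = x \<otimes>\<^bsub>presented_group R\<^esub> (y \<otimes>\<^bsub>presented_group R\<^esub> z)"
    using y by (auto simp: carr u)
qed

datatype two_gens = GenX | GenY

abbreviation "wx \<equiv> [(GenX, True)]"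
abbreviation "wx_inv \<equiv> [(GenX, False)]"
abbreviation "wy_inv \<equiv> [(GenY, False)]"
abbreviation "wy_pow n \<equiv> replicate n (GenY, True)"

text \<open>$D_{2n} = \langle x, y \mid y^n = 1,\ x^2 = 1,\ xyx^{-1} = y^{-1}\rangle$, the dihedral group
  of order \<open>2 * n\<close>.\<close>

definition dihedral_group :: "nat \<Rightarrow> two_gens word set monoid" where
  "dihedral_group n = presented_group
     {(wy_pow n, []),
      (wx @ wx, []),
      (wx @ wy_pow 1 @ wx_inv, wy_inv)}"

text \<open>$Q_{2^{t+1}m} = \langle x, y \mid y^{2^t m} = 1,\ x^2 = y^{2^{t-1}m},\ xyx^{-1} = y^{-1}\rangle$,
  of order \<open>2 ^ (t + 1) * m\<close>, for \<open>t \<ge> 1\<close>.\<close>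

definition quaternion_group :: "nat \<Rightarrow> nat \<Rightarrow> two_gens word set monoid" where
  "quaternion_group t m = presented_group
     {(wy_pow (2 ^ t * m), []),
      (wx @ wx, wy_pow (2 ^ (t - 1) * m)),
      (wx @ wy_pow 1 @ wx_inv, wy_inv)}"


section \<open>Spectra and energies of finite simple graphs\<close>

text \<open>Edges are two-element sets of vertices.\<close>

record 'a ugraph =
  vertices :: "'a set"
  edges :: "'a set set"

definition simple_graph :: "('a, 'b) ugraph_scheme \<Rightarrow> bool" where
  "simple_graph \<Gamma> \<longleftrightarrow> finite (vertices \<Gamma>) \<and> (\<forall>e\<in>edges \<Gamma>. e \<subseteq> vertices \<Gamma> \<and> card e = 2)"

definition vertex_degree :: "('a, 'b) ugraph_scheme \<Rightarrow> 'a \<Rightarrow> nat" where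
  "vertex_degree \<Gamma> v = card {e \<in> edges \<Gamma>. v \<in> e}"

text \<open>The matrices are taken with respect to an arbitrary enumeration of the vertex set; another
  enumeration gives a matrix conjugate by a permutation matrix, with the same eigenvalues.\<close>

definition vertex_list :: "('a, 'b) ugraph_scheme \<Rightarrow> 'a list" where
  "vertex_list \<Gamma> = (SOME vs. distinct vs \<and> set vs = vertices \<Gamma>)"

definition adjacency_matrix :: "('a, 'b) ugraph_scheme \<Rightarrow> real mat" where
  "adjacency_matrix \<Gamma> = mat (card (vertices \<Gamma>)) (card (vertices \<Gamma>))
     (\<lambda>(i, j). if {vertex_list \<Gamma> ! i, vertex_list \<Gamma> ! j} \<in> edges \<Gamma> then 1 else 0)"

definition degree_matrix :: "('a, 'b) ugraph_scheme \<Rightarrow> real mat" where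
  "degree_matrix \<Gamma> = mat (card (vertices \<Gamma>)) (card (vertices \<Gamma>))
     (\<lambda>(i, j). if i = j then real (vertex_degree \<Gamma> (vertex_list \<Gamma> ! i)) else 0)"

text \<open>Eigenvalues with multiplicity are the roots of the characteristic polynomial. All three
  matrices are real symmetric, so no eigenvalue is lost by considering real roots only, and
  algebraic and geometric multiplicities agree.\<close>

definition eigenvalue_mset :: "real mat \<Rightarrow> real multiset" where
  "eigenvalue_mset A = proots (char_poly A)"

definition Spec :: "('a, 'b) ugraph_scheme \<Rightarrow> real multiset" where
  "Spec \<Gamma> = eigenvalue_mset (adjacency_matrix \<Gamma>)"

definition L_spec :: "('a, 'b) ugraph_scheme \<Rightarrow> real multiset" where
  "L_spec \<Gamma> = eigenvalue_mset (degree_matrix \<Gamma> - adjacency_matrix \<Gamma>)"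

definition Q_spec :: "('a, 'b) ugraph_scheme \<Rightarrow> real multiset" where
  "Q_spec \<Gamma> = eigenvalue_mset (degree_matrix \<Gamma> + adjacency_matrix \<Gamma>)"

definition average_degree :: "('a, 'b) ugraph_scheme \<Rightarrow> real" where
  "average_degree \<Gamma> = 2 * real (card (edges \<Gamma>)) / real (card (vertices \<Gamma>))"

definition energy :: "('a, 'b) ugraph_scheme \<Rightarrow> real" where
  "energy \<Gamma> = (\<Sum>\<alpha>\<in>#Spec \<Gamma>. \<bar>\<alpha>\<bar>)"

definition L_energy :: "('a, 'b) ugraph_scheme \<Rightarrow> real" where
  "L_energy \<Gamma> = (\<Sum>\<mu>\<in>#L_spec \<Gamma>. \<bar>\<mu> - average_degree \<Gamma>\<bar>)"

definition Q_energy :: "('a, 'b) ugraph_scheme \<Rightarrow> real" where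
  "Q_energy \<Gamma> = (\<Sum>\<nu>\<in>#Q_spec \<Gamma>. \<bar>\<nu> - average_degree \<Gamma>\<bar>)"


section \<open>The graph $\mathcal{E}_c^-(G)$\<close>

definition engel_adjacent :: "('a, 'b) monoid_scheme \<Rightarrow> 'a \<Rightarrow> 'a \<Rightarrow> bool" where
  "engel_adjacent G x y \<longleftrightarrow> x \<noteq> y \<and>
     (\<forall>k\<ge>1. engel_commutator G x y k \<noteq> \<one>\<^bsub>G\<^esub> \<and> engel_commutator G y x k \<noteq> \<one>\<^bsub>G\<^esub>)"

definition engel_graph :: "('a, 'b) monoid_scheme \<Rightarrow> 'a ugraph" where
  "engel_graph G =
     \<lparr>vertices = carrier G - fitting_subgroup G,
      edges = {{x, y} | x y. x \<in> carrier G - fitting_subgroup G \<and>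
                             y \<in> carrier G - fitting_subgroup G \<and> engel_adjacent G x y}\<rparr>"

lemma simple_graph_engel_graph:
  assumes "finite (carrier G)"
  shows "simple_graph (engel_graph G)"
  using assms by (auto simp: simple_graph_def engel_graph_def engel_adjacent_def)

lemma engel_graph_adjacent_iff:
  "{x, y} \<in> edges (engel_graph G) \<longleftrightarrow>
     x \<in> vertices (engel_graph G) \<and> y \<in> vertices (engel_graph G) \<and> engel_adjacent G x y"
  by (auto simp: engel_graph_def engel_adjacent_def doubleton_eq_iff)

end

theory Submission
  imports Defs
begin

text \<open>In a group with elements \<open>y\<close> of order \<open>n = 2\<^sup>t m\<close> and \<open>x\<close> inverting \<open>y\<close>, whose elements are the
  \<open>y\<^sup>i\<close> and the \<open>x y\<^sup>i\<close>, the iterated commutator of \<open>x y\<^sup>i\<close> and \<open>x y\<^sup>j\<close> is a power of \<open>y\<close> with exponent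
  \<open>\<plusminus> 2\<^sup>k (i - j)\<close>. As \<open>m\<close> is odd, it is eventually trivial exactly if \<open>m\<close> divides \<open>i - j\<close>, and the
  same computation shows that no nilpotent normal subgroup contains an \<open>x y\<^sup>i\<close>, so the Fitting subgroup
  consists of the powers of \<open>y\<close>. The graph is therefore complete multipartite with \<open>m\<close> parts of size
  \<open>2\<^sup>t\<close>. Its matrices are \<open>k I + U V\<close>, where \<open>V\<close> is the incidence matrix of parts against vertices, and
  since \<open>U V\<close> and \<open>V U\<close> have the same characteristic polynomial up to a power of the variable, only
  an \<open>m \<times> m\<close> matrix remains.\<close>

section \<open>Characteristic polynomials\<close>

text \<open>The characteristic matrix keeps the zero block, so its determinant splits over the
  diagonal blocks.\<close>

lemma char_poly_four_block_upper_right_zero: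
  fixes A :: "'a :: idom mat"
  assumes A: "A \<in> carrier_mat n n" and C: "C \<in> carrier_mat m n" and D: "D \<in> carrier_mat m m"
  shows "char_poly (four_block_mat A (0\<^sub>m n m) C D) = char_poly A * char_poly D"
proof -
  have "char_poly_matrix (four_block_mat A (0\<^sub>m n m) C D)
      = four_block_mat (char_poly_matrix A) (0\<^sub>m n m) (map_mat (\<lambda>a. [:- a:]) C) (char_poly_matrix D)"
    using A C D by (intro eq_matI) (auto simp: char_poly_matrix_def)
  then show ?thesis
    unfolding char_poly_def
    using A C D det_four_block_mat_upper_right_zero[of "char_poly_matrix A" n "0\<^sub>m n m" m
        "map_mat (\<lambda>a. [:- a:]) C" "char_poly_matrix D"] by simp
qed

lemma char_poly_zero_mat: "char_poly (0\<^sub>m n n :: 'a :: idom mat) = [:0, 1:] ^ n"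
proof -
  have "char_poly_matrix (0\<^sub>m n n :: 'a mat) = [:0, 1:] \<cdot>\<^sub>m 1\<^sub>m n"
    by (intro eq_matI) (auto simp: char_poly_matrix_def)
  then show ?thesis by (simp add: char_poly_def)
qed

text \<open>Sylvester's identity: conjugation by the unipotent \<open>?P\<close> carries
  \<open>?B\<close> to \<open>?A\<close>, and both are block lower triangular. Powers of the
  variable on both sides cover \<open>n\<close> and \<open>m\<close> in either order.\<close>

lemma char_poly_mult_commute:
  fixes U V :: "'a :: idom mat"
  assumes U: "U \<in> carrier_mat n m" and V: "V \<in> carrier_mat m n"
  shows "[:0, 1:] ^ m * char_poly (U * V) = [:0, 1:] ^ n * char_poly (V * U)"
proof -
  let ?A = "four_block_mat (U * V) (0\<^sub>m n m) V (0\<^sub>m m m)"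
  let ?B = "four_block_mat (0\<^sub>m n n) (0\<^sub>m n m) V (V * U)"
  let ?P = "four_block_mat (1\<^sub>m n) U (0\<^sub>m m n) (1\<^sub>m m)"
  let ?Q = "four_block_mat (1\<^sub>m n) (- U) (0\<^sub>m m n) (1\<^sub>m m)"
  have UV: "U * V \<in> carrier_mat n n" "V * U \<in> carrier_mat m m" "- U \<in> carrier_mat n m" using U V by auto
  have one: "four_block_mat (1\<^sub>m n) (0\<^sub>m n m) (0\<^sub>m m n) (1\<^sub>m m) = (1\<^sub>m (n + m) :: 'a mat)"
    by (intro eq_matI) auto
  have zero: "- 0\<^sub>m m m = (0\<^sub>m m m :: 'a mat)" by (intro eq_matI) auto
  have "- U + U = 0\<^sub>m n m" "U + - U = 0\<^sub>m n m" using U by auto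
  then have PQ: "?P * ?Q = 1\<^sub>m (n + m)" and QP: "?Q * ?P = 1\<^sub>m (n + m)"
    using U UV mult_four_block_mat[of "1\<^sub>m n" n n U m "0\<^sub>m m n" m "1\<^sub>m m" "1\<^sub>m n" n "- U" m "0\<^sub>m m n" "1\<^sub>m m"]
      mult_four_block_mat[of "1\<^sub>m n" n n "- U" m "0\<^sub>m m n" m "1\<^sub>m m" "1\<^sub>m n" n U m "0\<^sub>m m n" "1\<^sub>m m"]
    by (simp_all add: one zero)
  have PB: "?P * ?B = four_block_mat (U * V) (U * (V * U)) V (V * U)"
    using U V UV by (subst mult_four_block_mat[where ?n1.0 = n and ?n2.0 = m]) auto
  \<comment> \<open>The right-hand blocks of \<open>?P * ?B * ?Q\<close> vanish; only the left-hand
    column \<open>U * V\<close>, \<open>V\<close> survives.\<close>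
  have "U * V * - U + U * (V * U) = 0\<^sub>m n m"
    using U V UV by (simp add: assoc_mult_mat[of U n m V n U m])
  moreover have "V * - U + V * U = 0\<^sub>m m m" using U V UV by simp
  ultimately have PBQ: "?P * ?B * ?Q = ?A"
    using U V UV unfolding PB by (subst mult_four_block_mat[where ?n1.0 = n and ?n2.0 = m]) auto
  have "similar_mat_wit ?A ?B ?P ?Q"
    by (rule similar_mat_witI[where n = "n + m", OF PQ QP PBQ[symmetric]]) (use U V UV in auto)
  then have "char_poly ?A = char_poly ?B"
    by (intro char_poly_similar) (auto simp: similar_mat_def)
  then have "char_poly (U * V) * [:0, 1:] ^ m = [:0, 1:] ^ n * char_poly (V * U)"
    unfolding char_poly_four_block_upper_right_zero[OF UV(1) V zero_carrier_mat]
      char_poly_four_block_upper_right_zero[OF zero_carrier_mat V UV(2)] char_poly_zero_mat .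
  then show ?thesis by (simp only: mult.commute)
qed

text \<open>Since x I - (k I + A) = (x - k) I - A, the scalar \<open>k\<close> shifts the argument;
  over the reals it suffices to compare values.\<close>

lemma char_poly_add_scalar:
  fixes A :: "real mat"
  assumes A: "A \<in> carrier_mat n n"
  shows "char_poly (k \<cdot>\<^sub>m 1\<^sub>m n + A) = pcompose (char_poly A) [:- k, 1:]"
proof (rule poly_eq_poly_eq_iff[THEN iffD1], rule ext)
  fix x
  have "- char_matrix (k \<cdot>\<^sub>m 1\<^sub>m n + A) x = - char_matrix A (x - k)"
    using A by (intro eq_matI) (auto simp: char_matrix_def)
  then show "poly (char_poly (k \<cdot>\<^sub>m 1\<^sub>m n + A)) x = poly (pcompose (char_poly A) [:- k, 1:]) x"
    using A by (simp add: char_poly_matrix[where n = n] poly_pcompose)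
qed

text \<open>The matrix is a column times a row; the reversed product is 1 by 1 with entry
  \<open>c * real m\<close>.\<close>

lemma char_poly_all_equal:
  fixes c :: real
  assumes "m > 0"
  shows "char_poly (mat m m (\<lambda>_. c)) = [:0, 1:] ^ (m - 1) * [:- (c * real m), 1:]"
proof -
  let ?U = "mat m 1 (\<lambda>_. c)" and ?V = "mat 1 m (\<lambda>_. 1 :: real)"
  have UV: "?U * ?V = mat m m (\<lambda>_. c)"
    by (intro eq_matI) (auto simp: scalar_prod_def)
  have VU: "?V * ?U = mat 1 1 (\<lambda>_. c * real m)"
    by (intro eq_matI) (auto simp: scalar_prod_def)
  have "char_poly (mat 1 1 (\<lambda>_. c * real m)) = [:- (c * real m), 1:]"
    by (simp add: char_poly_def char_poly_matrix_def det_single)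
  moreover have "[:0, 1 :: real:] ^ m = [:0, 1:] * [:0, 1:] ^ (m - 1)"
    using assms by (metis power_eq_if not_gr_zero)
  ultimately have "[:0, 1:] * char_poly (mat m m (\<lambda>_. c)) = [:0, 1:] * ([:0, 1:] ^ (m - 1) * [:- (c * real m), 1:])"
    using char_poly_mult_commute[of ?U m 1 ?V]
    unfolding UV VU by (simp only: power_one_right mat_carrier mult.assoc)
  then show ?thesis by (subst (asm) mult_left_cancel) auto
qed

lemma pcompose_linear_linear: "pcompose [:a, 1:] [:b, 1:] = [:a + b, 1:]" for a b :: "'a :: comm_ring_1"
  by (simp add: pcompose_pCons)

lemma pcompose_power: "pcompose (p ^ n) q = pcompose p q ^ n" for p q :: "'a :: comm_ring_1 poly"
  by (induction n) (auto simp: pcompose_mult pcompose_1)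

lemma char_poly_scalar_plus_all_equal:
  fixes b c :: real
  assumes "m > 0"
  shows "char_poly (mat m m (\<lambda>(i, j). (if i = j then b else 0) + c))
    = [:- b, 1:] ^ (m - 1) * [:- (b + c * real m), 1:]"
proof -
  have "mat m m (\<lambda>(i, j). (if i = j then b else 0) + c) = b \<cdot>\<^sub>m 1\<^sub>m m + mat m m (\<lambda>_. c)"
    by (intro eq_matI) auto
  then show ?thesis
    using char_poly_add_scalar[of "mat m m (\<lambda>_. c)" m b]
    by (simp only: mat_carrier char_poly_all_equal[OF assms] pcompose_mult pcompose_power
        pcompose_linear_linear) (simp only: add_0 minus_add_distrib add.commute)
qed

text \<open>The matrix \<open>?A\<close> factors through the parts. The reversed product
  \<open>?C\<close> is the quotient matrix, 0 on and \<open>e * real s\<close> off the diagonal,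
  hence a scalar plus a constant matrix. The parameters \<open>k\<close> and \<open>e\<close> cover
  adjacency, Laplacian and signless Laplacian at once.\<close>

lemma char_poly_multipartite:
  fixes k e :: real
  assumes m: "m > 0" and s: "s > 0" and n: "n = m * s"
    and f: "\<And>i. i < n \<Longrightarrow> f i < m"
    and part: "\<And>q. q < m \<Longrightarrow> card {i. i < n \<and> f i = q} = s"
  shows "char_poly (mat n n (\<lambda>(i, j). (if i = j then k else 0) + (if f i = f j then 0 else e)))
    = [:- k, 1:] ^ (m * (s - 1)) * [:- (k - e * real s), 1:] ^ (m - 1)
      * [:- (k + e * real s * (real m - 1)), 1:]"
proof -
  let ?A = "mat n n (\<lambda>(i, j). if f i = f j then 0 else e)"
  let ?U = "mat n m (\<lambda>(i, q). if f i = q then 0 else e)"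
  let ?V = "mat m n (\<lambda>(q, i). if f i = q then 1 else 0 :: real)"
  let ?C = "mat m m (\<lambda>(p, q). (if p = q then - e * real s else 0) + e * real s)"
  have UV: "?U * ?V = ?A"
  proof (intro eq_matI)
    fix i j assume ij: "i < dim_row ?A" "j < dim_col ?A"
    then have "(?U * ?V) $$ (i, j) = (\<Sum>q = 0..<m. (if f i = q then 0 else e) * (if f j = q then 1 else 0))"
      by (simp add: scalar_prod_def)
    also have "\<dots> = (\<Sum>q = 0..<m. if q = f j then (if f i = q then 0 else e) else 0)"
      by (intro sum.cong) auto
    also have "\<dots> = ?A $$ (i, j)" using ij f by simp
    finally show "(?U * ?V) $$ (i, j) = ?A $$ (i, j)" .
  qed auto
  have VU: "?V * ?U = ?C"
  proof (intro eq_matI)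
    fix p q assume pq: "p < dim_row ?C" "q < dim_col ?C"
    then have "(?V * ?U) $$ (p, q) = (\<Sum>i = 0..<n. (if f i = p then 1 else 0) * (if f i = q then 0 else e))"
      by (simp add: scalar_prod_def)
    also have "\<dots> = (\<Sum>i = 0..<n. if f i = p then (if p = q then 0 else e) else 0)"
      by (intro sum.cong) auto
    also have "\<dots> = (\<Sum>i\<in>{i. i < n \<and> f i = p}. if p = q then 0 else e)"
      by (intro sum.mono_neutral_cong_right) auto
    also have "\<dots> = ?C $$ (p, q)" using pq part by simp
    finally show "(?V * ?U) $$ (p, q) = ?C $$ (p, q)" .
  qed auto
  have "[:0, 1:] ^ m * char_poly ?A = [:0, 1:] ^ n * char_poly ?C"
    using char_poly_mult_commute[of ?U n m ?V] unfolding UV VU by simp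
  \<comment> \<open>After cancelling X^m a factor X^(m (s - 1)) remains, which the shift turns into
    the eigenvalue \<open>k\<close>.\<close>
  moreover have "n = m + m * (s - 1)" using s n by (cases s) auto
  then have "[:0, 1 :: real:] ^ n = [:0, 1:] ^ m * [:0, 1:] ^ (m * (s - 1))" by (metis power_add)
  ultimately have "[:0, 1:] ^ m * char_poly ?A = [:0, 1:] ^ m * ([:0, 1:] ^ (m * (s - 1)) * char_poly ?C)"
    by (simp only: mult.assoc)
  then have A: "char_poly ?A = [:0, 1:] ^ (m * (s - 1)) * char_poly ?C"
    by (subst (asm) mult_left_cancel) auto
  have "mat n n (\<lambda>(i, j). (if i = j then k else 0) + (if f i = f j then 0 else e)) = k \<cdot>\<^sub>m 1\<^sub>m n + ?A"
    by (intro eq_matI) auto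
  then have "char_poly (mat n n (\<lambda>(i, j). (if i = j then k else 0) + (if f i = f j then 0 else e)))
    = pcompose ([:0, 1:] ^ (m * (s - 1)) * char_poly ?C) [:- k, 1:]"
    by (simp add: char_poly_add_scalar[where n = n] A)
  moreover have "- (- e * real s) + - k = - (k - e * real s)"
    "- (- e * real s + e * real s * real m) + - k = - (k + e * real s * (real m - 1))"
    by (simp_all add: algebra_simps)
  ultimately show ?thesis
    by (simp only: char_poly_scalar_plus_all_equal[OF m] pcompose_mult pcompose_power
        pcompose_linear_linear add_0 mult.assoc)
qed

lemma proots_three_factors:
  fixes a b c :: real
  shows "proots ([:- a, 1:] ^ i * [:- b, 1:] ^ j * [:- c, 1:])
    = replicate_mset i a + replicate_mset j b + replicate_mset 1 c"
proof -
  have lin: "proots ([:- a, 1:] ^ i) = replicate_mset i a" for i and a :: real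
    by (induction i) (simp_all add: proots_power del: power_Suc)
  have "[:- a, 1:] ^ i \<noteq> 0" "[:- b, 1:] ^ j \<noteq> 0" "[:- c, 1:] \<noteq> 0" by simp_all
  then show ?thesis
    using lin[of c 1] by (simp only: proots_mult mult_eq_0_iff lin power_one_right not_False_eq_True de_Morgan_disj simp_thms)
qed

section \<open>Balanced complete multipartite graphs\<close>

text \<open>The parts are given by a labelling rather than a set partition, so that the labels serve
  as matrix indices.\<close>

locale balanced_multipartite =
  fixes \<Gamma> :: "('a, 'b) ugraph_scheme" and part :: "'a \<Rightarrow> nat" and m s :: nat
  assumes simple: "simple_graph \<Gamma>"
    and m_pos: "m > 0" and s_pos: "s > 0"
    and part_less: "v \<in> vertices \<Gamma> \<Longrightarrow> part v < m"
    and card_part: "q < m \<Longrightarrow> card {v \<in> vertices \<Gamma>. part v = q} = s"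
    and edge_iff: "u \<in> vertices \<Gamma> \<Longrightarrow> v \<in> vertices \<Gamma> \<Longrightarrow> {u, v} \<in> edges \<Gamma> \<longleftrightarrow> part u \<noteq> part v"
begin

lemma finite_vertices: "finite (vertices \<Gamma>)"
  and edgeD: "e \<in> edges \<Gamma> \<Longrightarrow> e \<subseteq> vertices \<Gamma> \<and> card e = 2"
  using simple by (auto simp: simple_graph_def)

lemma finite_edges: "finite (edges \<Gamma>)"
  by (rule finite_subset[of _ "Pow (vertices \<Gamma>)"]) (use edgeD finite_vertices in auto)

lemma card_vertices: "card (vertices \<Gamma>) = m * s"
proof -
  have "card (vertices \<Gamma>) = (\<Sum>q\<in>{..<m}. \<Sum>v\<in>{v \<in> vertices \<Gamma>. part v = q}. 1)"
    using sum.group[OF finite_vertices, of "{..<m}" part "\<lambda>_. 1 :: nat"] part_less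
    by (simp add: image_subset_iff)
  also have "\<dots> = (\<Sum>q\<in>{..<m}. s)"
    using card_part by (intro sum.cong) auto
  finally show ?thesis by simp
qed

text \<open>Edges at \<open>v\<close> correspond to their other endpoints, the vertices outside the
  part of \<open>v\<close>.\<close>

lemma vertex_degree_eq:
  assumes v: "v \<in> vertices \<Gamma>"
  shows "vertex_degree \<Gamma> v = s * (m - 1)"
proof -
  have "{e \<in> edges \<Gamma>. v \<in> e} = (\<lambda>w. {v, w}) ` {w \<in> vertices \<Gamma>. part w \<noteq> part v}"
  proof (intro equalityI subsetI)
    fix e assume e: "e \<in> {e \<in> edges \<Gamma>. v \<in> e}"
    then have "card e = 2" "e \<subseteq> vertices \<Gamma>" using edgeD by auto
    then obtain a b where "e = {a, b}" by (auto simp: card_2_iff)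
    with e obtain w where w: "e = {v, w}" by auto
    with e \<open>e \<subseteq> vertices \<Gamma>\<close> edge_iff[OF v, of w] show "e \<in> (\<lambda>w. {v, w}) ` {w \<in> vertices \<Gamma>. part w \<noteq> part v}"
      by auto
  qed (use v edge_iff in auto)
  then have "vertex_degree \<Gamma> v = card {w \<in> vertices \<Gamma>. part w \<noteq> part v}"
    unfolding vertex_degree_def by (simp add: card_image inj_on_def doubleton_eq_iff)
  also have "{w \<in> vertices \<Gamma>. part w \<noteq> part v} = vertices \<Gamma> - {w \<in> vertices \<Gamma>. part w = part v}"
    by auto
  also have "card \<dots> = m * s - s"
    using card_part[OF part_less[OF v]] finite_vertices by (subst card_Diff_subset) (auto simp: card_vertices)
  finally show ?thesis by (simp add: algebra_simps)
qed

lemma average_degree_eq: "average_degree \<Gamma> = real s * (real m - 1)"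
proof -
  have "(\<Sum>v\<in>vertices \<Gamma>. card {e \<in> edges \<Gamma>. v \<in> e}) = 2 * card (edges \<Gamma>)"
  proof (rule sum_multicount[OF finite_vertices finite_edges], rule ballI)
    fix e assume "e \<in> edges \<Gamma>"
    then have "{v \<in> vertices \<Gamma>. v \<in> e} = e" "card e = 2" using edgeD by auto
    then show "card {v \<in> vertices \<Gamma>. v \<in> e} = 2" by simp
  qed
  then have "2 * card (edges \<Gamma>) = card (vertices \<Gamma>) * (s * (m - 1))"
    using vertex_degree_eq by (simp add: vertex_degree_def)
  then have "2 * real (card (edges \<Gamma>)) = real (card (vertices \<Gamma>)) * (real s * real (m - 1))"
    by (metis of_nat_mult of_nat_numeral)
  then show ?thesis
    using m_pos s_pos by (simp add: average_degree_def card_vertices of_nat_diff)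
qed

lemma vertex_list: "distinct (vertex_list \<Gamma>)" "set (vertex_list \<Gamma>) = vertices \<Gamma>"
  using someI_ex[OF finite_distinct_list[OF finite_vertices]]
  by (auto simp: vertex_list_def conj_commute)

lemma length_vertex_list: "length (vertex_list \<Gamma>) = m * s"
  using vertex_list distinct_card card_vertices by metis

lemma nth_vertex_list: "i < m * s \<Longrightarrow> vertex_list \<Gamma> ! i \<in> vertices \<Gamma>"
  using vertex_list length_vertex_list nth_mem by metis

text \<open>The enumeration of the vertices is arbitrary, but it is a bijection, so each part owns
  exactly \<open>s\<close> indices.\<close>

lemma eigenvalue_mset_multipartite:
  "eigenvalue_mset (mat (m * s) (m * s) (\<lambda>(i, j). (if i = j then k else 0)
      + (if part (vertex_list \<Gamma> ! i) = part (vertex_list \<Gamma> ! j) then 0 else e)))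
    = replicate_mset (m * (s - 1)) k + replicate_mset (m - 1) (k - e * real s)
      + replicate_mset 1 (k + e * real s * (real m - 1))"
proof -
  have "card {i. i < m * s \<and> part (vertex_list \<Gamma> ! i) = q} = s" if "q < m" for q
  proof -
    have "{v \<in> vertices \<Gamma>. part v = q} = (!) (vertex_list \<Gamma>) ` {i. i < m * s \<and> part (vertex_list \<Gamma> ! i) = q}"
      using vertex_list(2) length_vertex_list by (auto simp: set_conv_nth)
    moreover have "inj_on ((!) (vertex_list \<Gamma>)) {i. i < m * s \<and> part (vertex_list \<Gamma> ! i) = q}"
      using vertex_list(1) length_vertex_list by (auto simp: inj_on_def nth_eq_iff_index_eq)
    ultimately show ?thesis using card_part[OF that] by (simp add: card_image)
  qed
  then show ?thesis
    unfolding eigenvalue_mset_def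
    by (subst char_poly_multipartite[OF m_pos s_pos HOL.refl])
       (rule part_less nth_vertex_list proots_three_factors | assumption)+
qed

section \<open>Matrices, spectra and energies of the multipartite graph\<close>

lemma adjacency_matrix_eq:
  "adjacency_matrix \<Gamma> = mat (m * s) (m * s)
    (\<lambda>(i, j). if part (vertex_list \<Gamma> ! i) = part (vertex_list \<Gamma> ! j) then 0 else 1)"
  unfolding adjacency_matrix_def card_vertices
  by (intro eq_matI) (auto simp: edge_iff nth_vertex_list)

lemma degree_matrix_eq:
  "degree_matrix \<Gamma> = mat (m * s) (m * s) (\<lambda>(i, j). if i = j then real s * (real m - 1) else 0)"
  unfolding degree_matrix_def card_vertices using m_pos
  by (intro eq_matI) (auto simp: vertex_degree_eq nth_vertex_list of_nat_diff)

lemma Spec_eq: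
  "Spec \<Gamma> = replicate_mset (m * (s - 1)) 0 + replicate_mset (m - 1) (- real s)
    + replicate_mset 1 (real s * (real m - 1))"
proof -
  have "adjacency_matrix \<Gamma> = mat (m * s) (m * s) (\<lambda>(i, j). (if i = j then 0 else 0)
      + (if part (vertex_list \<Gamma> ! i) = part (vertex_list \<Gamma> ! j) then 0 else 1))"
    unfolding adjacency_matrix_eq by (intro eq_matI) auto
  then show ?thesis unfolding Spec_def by (simp only: eigenvalue_mset_multipartite) simp
qed

text \<open>Here \<open>k\<close> is the common degree and \<open>e = - 1\<close>, which sends the
  simple eigenvalue to 0.\<close>

lemma L_spec_eq:
  "L_spec \<Gamma> = replicate_mset 1 0 + replicate_mset (m * (s - 1)) (real s * (real m - 1))
    + replicate_mset (m - 1) (real s * real m)"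
proof -
  have "degree_matrix \<Gamma> - adjacency_matrix \<Gamma> = mat (m * s) (m * s)
      (\<lambda>(i, j). (if i = j then real s * (real m - 1) else 0)
      + (if part (vertex_list \<Gamma> ! i) = part (vertex_list \<Gamma> ! j) then 0 else - 1))"
    unfolding adjacency_matrix_eq degree_matrix_eq by (intro eq_matI) auto
  moreover have "real s * (real m - 1) - - 1 * real s = real s * real m"
    "real s * (real m - 1) + - 1 * real s * (real m - 1) = 0"
    by (simp_all add: algebra_simps)
  ultimately show ?thesis
    unfolding L_spec_def by (simp only: eigenvalue_mset_multipartite) simp
qed

lemma Q_spec_eq:
  "Q_spec \<Gamma> = replicate_mset (m * (s - 1)) (real s * (real m - 1))
    + replicate_mset (m - 1) (real s * (real m - 2)) + replicate_mset 1 (2 * real s * (real m - 1))"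
proof -
  have "degree_matrix \<Gamma> + adjacency_matrix \<Gamma> = mat (m * s) (m * s)
      (\<lambda>(i, j). (if i = j then real s * (real m - 1) else 0)
      + (if part (vertex_list \<Gamma> ! i) = part (vertex_list \<Gamma> ! j) then 0 else 1))"
    unfolding adjacency_matrix_eq degree_matrix_eq by (intro eq_matI) auto
  moreover have "real s * (real m - 1) - 1 * real s = real s * (real m - 2)"
    "real s * (real m - 1) + 1 * real s * (real m - 1) = 2 * real s * (real m - 1)"
    by (simp_all add: algebra_simps)
  ultimately show ?thesis
    unfolding Q_spec_def by (simp only: eigenvalue_mset_multipartite)
qed

lemma energy_eq: "energy \<Gamma> = 2 * real s * (real m - 1)"
  using m_pos by (simp add: energy_def Spec_eq of_nat_diff abs_mult)

text \<open>The average degree is the common degree, so the eigenvalue of multiplicity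
  \<open>m * (s - 1)\<close> contributes nothing; the eigenvalue 0 contributes
  \<open>s * (m - 1)\<close> and each of the remaining \<open>m - 1\<close> contributes
  \<open>s\<close>.\<close>

lemma L_energy_eq: "L_energy \<Gamma> = 2 * real s * (real m - 1)"
proof -
  have "real s * real m - real s * (real m - 1) = real s" by (simp add: algebra_simps)
  then show ?thesis
    using m_pos by (simp add: L_energy_def L_spec_eq average_degree_eq of_nat_diff abs_mult)
qed

lemma Q_energy_eq: "Q_energy \<Gamma> = 2 * real s * (real m - 1)"
proof -
  have "real s * (real m - 2) - real s * (real m - 1) = - real s"
    "2 * real s * (real m - 1) - real s * (real m - 1) = real s * (real m - 1)"
    by (simp_all add: algebra_simps)
  then show ?thesis
    using m_pos by (simp add: Q_energy_def Q_spec_eq average_degree_eq of_nat_diff abs_mult)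
qed

end

section \<open>Groups of dihedral type\<close>

text \<open>Solving \<open>a \<otimes> b = b \<otimes> a \<otimes> c\<close> for \<open>c\<close>
  gives the commutator, so commutators can be found by comparing two products.\<close>

lemma (in group) commutator_eqI:
  assumes "a \<in> carrier G" "b \<in> carrier G" "c \<in> carrier G" "a \<otimes> b = b \<otimes> a \<otimes> c"
  shows "commutator G a b = c"
proof -
  have "commutator G a b = inv a \<otimes> (inv b \<otimes> (a \<otimes> b))"
    using assms by (simp add: commutator_def m_assoc)
  also have "\<dots> = inv a \<otimes> (inv b \<otimes> (b \<otimes> (a \<otimes> c)))"
    using assms by (simp add: m_assoc)
  also have "\<dots> = c"
    using assms by (simp add: m_assoc[symmetric])
  finally show ?thesis .
qed

lemma (in group) commutator_subgroup:
  assumes "subgroup N G" "a \<in> N" "b \<in> N"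
  shows "commutator (G\<lparr>carrier := N\<rparr>) a b = commutator G a b"
  using assms by (simp add: commutator_def m_inv_consistent)

lemma comm_group_imp_nilpotent:
  assumes "comm_group K"
  shows "nilpotent_group K"
proof -
  interpret comm_group K by (rule assms)
  have "commutator K a b = \<one>\<^bsub>K\<^esub>" if "a \<in> carrier K" "b \<in> carrier K" for a b
    using that by (intro commutator_eqI) (auto simp: m_comm)
  then have "{commutator K a b | a b. a \<in> carrier K \<and> b \<in> carrier K} = {\<one>\<^bsub>K\<^esub>}"
    by (auto intro!: exI[of _ "\<one>\<^bsub>K\<^esub>"])
  then have "lower_central K (Suc 0) = {\<one>\<^bsub>K\<^esub>}"
    by (simp add: generate_one)
  then show ?thesis unfolding nilpotent_group_def using is_group by blast
qed

text \<open>The relation for the square of \<open>x\<close>, the only one in which the dihedral and the generalised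
  quaternion groups differ, plays no role for commutators.\<close>

locale dihedral_type = group G for G (structure) +
  fixes x y :: 'a and n :: nat
  assumes x_closed [simp]: "x \<in> carrier G" and y_closed [simp]: "y \<in> carrier G"
    and carrier_cases: "g \<in> carrier G \<Longrightarrow> \<exists>i::int. g = y [^] i \<or> g = x \<otimes> y [^] i"
    and int_pow_y_eq_one: "y [^] (i::int) = \<one> \<longleftrightarrow> int n dvd i"
    and x_neq_int_pow_y: "x \<noteq> y [^] (i::int)"
    and y_x: "y \<otimes> x = x \<otimes> inv y"
begin

abbreviation rot :: "int \<Rightarrow> 'a" where "rot i \<equiv> y [^] i"
abbreviation refl :: "int \<Rightarrow> 'a" where "refl i \<equiv> x \<otimes> rot i"

section \<open>Products and commutators of rotations and reflections\<close>

lemma rot_mult: "rot i \<otimes> rot j = rot (i + j)"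
  by (simp add: int_pow_mult)

lemma rot_x_nat: "rot (int k) \<otimes> x = refl (- int k)"
proof (induction k)
  case (Suc k)
  have "rot (int (Suc k)) \<otimes> x = rot (int k) \<otimes> (rot 1 \<otimes> x)"
    by (simp add: m_assoc[symmetric] rot_mult add.commute del: int_pow_1)
  also have "\<dots> = (rot (int k) \<otimes> x) \<otimes> rot (- 1)"
    using y_x by (simp add: m_assoc int_pow_neg)
  also have "\<dots> = refl (- int (Suc k))"
    unfolding Suc.IH by (simp add: m_assoc rot_mult algebra_simps)
  finally show ?case .
qed simp

lemma rot_x: "rot i \<otimes> x = refl (- i)"
proof (cases "i \<ge> 0")
  case True
  then show ?thesis using rot_x_nat[of "nat i"] by simp
next
  case False
  \<comment> \<open>For negative \<open>i\<close> the natural case applies to \<open>- i\<close>;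
    multiplying by \<open>rot i\<close> on the left and \<open>rot (- i)\<close> on the right
    inverts it.\<close>
  then have "rot i \<otimes> refl i = rot i \<otimes> (rot (- i) \<otimes> x)"
    using rot_x_nat[of "nat (- i)"] by simp
  also have "\<dots> = x"
    by (simp add: m_assoc[symmetric] rot_mult)
  finally have "rot i \<otimes> refl i \<otimes> rot (- i) = refl (- i)" by simp
  then show ?thesis by (simp add: m_assoc rot_mult)
qed

lemma rot_refl: "rot i \<otimes> refl j = refl (j - i)"
  using rot_x[of i] by (simp add: m_assoc[symmetric]) (simp add: m_assoc rot_mult)

lemma refl_rot: "refl i \<otimes> rot j = refl (i + j)"
  by (simp add: m_assoc rot_mult)

text \<open>The factor \<open>x \<otimes> x\<close> stays unevaluated, as its value differs between
  the two families of groups.\<close>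

lemma refl_refl: "refl i \<otimes> refl j = x \<otimes> refl (j - i)"
  using rot_refl by (simp add: m_assoc)

text \<open>Both orders of the product carry the same left factor \<open>x \<otimes> x\<close>; it
  cancels and leaves the difference of the exponents \<open>j - i\<close> and
  \<open>i - j\<close>.\<close>

lemma commutator_refl_refl: "commutator G (refl i) (refl j) = rot (2 * (j - i))"
  by (rule commutator_eqI) (simp_all add: refl_refl m_assoc rot_mult algebra_simps)

text \<open>Every reflection inverts rotations under conjugation, so the result is independent of
  \<open>j\<close>.\<close>

lemma commutator_rot_refl: "commutator G (rot i) (refl j) = rot (- 2 * i)"
  by (rule commutator_eqI) (simp_all add: rot_refl refl_rot algebra_simps)

lemma rot_eq_iff: "rot i = rot j \<longleftrightarrow> int n dvd i - j"
proof -
  have "rot i = rot j \<longleftrightarrow> rot i \<otimes> rot (- j) = rot j \<otimes> rot (- j)"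
    by simp
  then show ?thesis by (simp only: rot_mult) (simp add: int_pow_y_eq_one)
qed

lemma refl_eq_iff: "refl i = refl j \<longleftrightarrow> int n dvd i - j"
  by (simp add: rot_eq_iff)

lemma refl_neq_rot: "refl i \<noteq> rot j"
proof
  assume "refl i = rot j"
  then have "refl i \<otimes> rot (- i) = rot (j - i)" by (simp add: rot_mult)
  then show False using x_neq_int_pow_y[of "j - i"] by (simp add: m_assoc rot_mult)
qed

text \<open>The first commutator is a rotation, and each further commutator with
  \<open>refl j\<close> multiplies the exponent by \<open>- 2\<close>. The index is
  \<open>Suc k\<close> because the recursion starts at \<open>refl i\<close> itself.\<close>

lemma engel_commutator_refl:
  "engel_commutator G (refl i) (refl j) (Suc k) = rot ((- 2) ^ k * (2 * (j - i)))"
proof (induction k)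
  case 0
  then show ?case by (simp add: commutator_refl_refl)
next
  case (Suc k)
  then show ?case
    unfolding engel_commutator.simps(2)[of _ _ _ "Suc k"]
    by (simp only: Suc.IH commutator_rot_refl power_Suc mult.assoc)
qed

text \<open>Divisibility by \<open>n\<close> ignores signs, so both orders of the vertices yield the
  same condition. Distinctness of the vertices is the case \<open>k = 0\<close>; the commutators
  supply the positive \<open>k\<close>.\<close>

lemma engel_adjacent_refl_iff:
  "engel_adjacent G (refl i) (refl j) \<longleftrightarrow> (\<forall>k. \<not> int n dvd 2 ^ k * (i - j))"
proof -
  have dvd: "int n dvd (- 2) ^ k * (2 * (b - a)) \<longleftrightarrow> int n dvd 2 ^ Suc k * (a - b)" for k a b
  proof -
    have "(- 2) ^ k * (2 * (b - a)) = - ((- 1) ^ k * (2 ^ Suc k * (a - b)))"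
      by (subst power_minus) (simp add: algebra_simps)
    also have "\<dots> = (- 1) ^ Suc k * (2 ^ Suc k * (a - b))" by simp
    finally show ?thesis by (cases "even k") simp_all
  qed
  have sym: "int n dvd 2 ^ k * (j - i) \<longleftrightarrow> int n dvd 2 ^ k * (i - j)" for k
    by (metis dvd_minus_iff minus_diff_eq mult_minus_right)
  have "engel_adjacent G (refl i) (refl j) \<longleftrightarrow> \<not> int n dvd i - j \<and>
      (\<forall>k. engel_commutator G (refl i) (refl j) (Suc k) \<noteq> \<one> \<and>
           engel_commutator G (refl j) (refl i) (Suc k) \<noteq> \<one>)"
    unfolding engel_adjacent_def refl_eq_iff One_nat_def using Suc_le_D by blast
  also have "\<dots> \<longleftrightarrow> \<not> int n dvd 2 ^ 0 * (i - j) \<and> (\<forall>k. \<not> int n dvd 2 ^ Suc k * (i - j))"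
    unfolding engel_commutator_refl int_pow_y_eq_one dvd sym by simp
  also have "\<dots> \<longleftrightarrow> (\<forall>k. \<not> int n dvd 2 ^ k * (i - j))"
    by (metis not0_implies_Suc)
  finally show ?thesis .
qed

section \<open>The rotation subgroup and the Fitting subgroup\<close>

lemma subgroup_rot: "subgroup (range rot) G"
  using generate_is_subgroup[of "{y}"] generate_pow[of y] by (simp add: full_SetCompr_eq)

lemma normal_rot: "range rot \<lhd> G"
proof (rule normal_invI[OF subgroup_rot])
  fix h g assume "h \<in> range rot" "g \<in> carrier G"
  then obtain i j where h: "h = rot i" and g: "g = rot j \<or> g = refl j"
    using carrier_cases by blast
  have "g \<otimes> h \<otimes> inv g = rot (- i)" if "g = refl j"
  proof -
    have "g \<otimes> h = rot (- i) \<otimes> g" using that h by (simp add: rot_refl refl_rot add.commute)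
    then show ?thesis using \<open>g \<in> carrier G\<close> by (simp add: m_assoc)
  qed
  moreover have "g \<otimes> h \<otimes> inv g = rot i" if "g = rot j"
    using that h by (simp add: rot_mult int_pow_neg[symmetric])
  ultimately show "g \<otimes> h \<otimes> inv g \<in> range rot" using g by blast
qed

lemma nilpotent_rot: "nilpotent_group (G\<lparr>carrier := range rot\<rparr>)"
  by (intro comm_group_imp_nilpotent group.group_comm_groupI subgroup_imp_group subgroup_rot)
     (auto simp: rot_mult add.commute)

text \<open>A normal subgroup containing a reflection contains \<open>rot (- 2)\<close>, and commutators with that
  reflection multiply the exponent by \<open>- 2\<close> at each step of the lower central series.\<close>

lemma nilpotent_normal_subset_rot:
  assumes n: "\<And>k. \<not> int n dvd 2 ^ k"
    and N: "N \<lhd> G" and nil: "nilpotent_group (G\<lparr>carrier := N\<rparr>)"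
  shows "N \<subseteq> range rot"
proof (rule ccontr)
  assume "\<not> N \<subseteq> range rot"
  moreover have sub: "subgroup N G" using N by (rule normal_imp_subgroup)
  ultimately obtain i where i: "refl i \<in> N"
    using carrier_cases subgroup.mem_carrier[OF sub] by blast
  have inN: "rot (- 2) \<in> N"
  proof -
    \<comment> \<open>Conjugating the reflection by \<open>y\<close> lowers its index by 2; the
      quotient of the two reflections is \<open>rot (- 2)\<close>.\<close>
    have "rot 1 \<otimes> refl i \<otimes> inv (rot 1) = refl (i - 2)"
      by (simp only: rot_refl int_pow_neg[symmetric] y_closed refl_rot) simp
    then have "refl (i - 2) \<in> N"
      using normal_invE(2)[OF N _ i, of "rot 1"] by simp
    have "refl (i - 2) = refl i \<otimes> rot (- 2)" by (simp only: refl_rot) simp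
    moreover have "inv a \<otimes> (a \<otimes> b) = b" if "a \<in> carrier G" "b \<in> carrier G" for a b
      using that by (simp add: m_assoc[symmetric])
    ultimately have "rot (- 2) = inv (refl i) \<otimes> refl (i - 2)" by simp
    with \<open>refl (i - 2) \<in> N\<close> show ?thesis
      using i sub by (simp add: subgroup.m_closed subgroup.m_inv_closed del: inv_mult_group)
  qed
  \<comment> \<open>Membership in \<open>N\<close> is carried along because commutators in
    \<open>N\<close> and in \<open>G\<close> are identified only for elements of
    \<open>N\<close>.\<close>
  have lower: "rot ((- 2) ^ Suc k) \<in> N \<and> rot ((- 2) ^ Suc k) \<in> lower_central (G\<lparr>carrier := N\<rparr>) k" for k
  proof (induction k)
    case 0
    then show ?case using inN by simp
  next
    case (Suc k)
    have comm: "commutator (G\<lparr>carrier := N\<rparr>) (rot ((- 2) ^ Suc k)) (refl i) = rot ((- 2) ^ Suc (Suc k))"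
      using Suc.IH i sub by (simp only: commutator_subgroup commutator_rot_refl power_Suc)
    have "rot ((- 2) ^ Suc (Suc k)) \<in> N"
      using Suc.IH i sub unfolding comm[symmetric] commutator_def
      by (simp add: m_inv_consistent subgroup.m_closed subgroup.m_inv_closed del: inv_mult_group power_Suc)
    moreover have "rot ((- 2) ^ Suc (Suc k)) \<in> lower_central (G\<lparr>carrier := N\<rparr>) (Suc k)"
      unfolding lower_central.simps
      by (rule generate.incl) (use comm Suc.IH i in force)
    ultimately show ?case by blast
  qed
  obtain k where "lower_central (G\<lparr>carrier := N\<rparr>) k = {\<one>}"
    using nil unfolding nilpotent_group_def by auto
  then have "rot ((- 2) ^ Suc k) = \<one>" using lower[of k] by (metis singletonD)
  then have "int n dvd (- 2) ^ Suc k" by (simp only: int_pow_y_eq_one)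
  then have "int n dvd 2 ^ Suc k"
    by (subst (asm) power_minus) (metis dvd_mult_unit_iff' is_unit_power_iff minus_dvd_iff one_dvd)
  then show False using n by blast
qed

text \<open>The rotations form an abelian normal subgroup, hence one of those generating the Fitting
  subgroup, and all the others lie inside it.\<close>

lemma fitting_subgroup_eq:
  assumes "\<And>k. \<not> int n dvd 2 ^ k"
  shows "fitting_subgroup G = range rot"
proof
  show "fitting_subgroup G \<subseteq> range rot"
    unfolding fitting_subgroup_def
    by (rule generate_subgroup_incl[OF _ subgroup_rot])
       (use nilpotent_normal_subset_rot[OF assms] in auto)
  show "range rot \<subseteq> fitting_subgroup G"
    unfolding fitting_subgroup_def
    using normal_rot nilpotent_rot by (auto intro!: generate.incl)
qed

lemma vertices_engel_graph:
  assumes "\<And>k. \<not> int n dvd 2 ^ k"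
  shows "vertices (engel_graph G) = range refl"
  unfolding engel_graph_def ugraph.simps fitting_subgroup_eq[OF assms]
  using carrier_cases refl_neq_rot by (auto dest: carrier_cases)

lemma finite_range_refl:
  assumes "n > 0"
  shows "finite (range refl)"
proof (rule finite_subset)
  show "range refl \<subseteq> refl ` {0..<int n}"
  proof
    fix v assume "v \<in> range refl"
    then obtain i where "v = refl i" by blast
    then have "v = refl (i mod int n)" by (simp only: refl_eq_iff) (simp add: mod_eq_dvd_iff[symmetric])
    then show "v \<in> refl ` {0..<int n}" using assms by auto
  qed
qed simp

end

text \<open>Carries the structure from a presented group to its isomorphic copies: normal forms come
  from surjectivity, the order of \<open>y\<close> and the separation of \<open>x\<close> from the
  powers of \<open>y\<close> from injectivity.\<close>

lemma dihedral_type_iso: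
  assumes "dihedral_type P x y n" "h \<in> iso P G" "group G"
  shows "dihedral_type G (h x) (h y) n"
proof -
  interpret P: dihedral_type P x y n by (rule assms)
  interpret G: group G by (rule assms)
  have hom: "h \<in> hom P G" and inj: "inj_on h (carrier P)" and surj: "h ` carrier P = carrier G"
    using assms(2) by (auto simp: iso_iff)
  interpret group_hom P G h by (unfold_locales) (rule hom)
  have pow: "h y [^]\<^bsub>G\<^esub> i = h (y [^]\<^bsub>P\<^esub> i)" for i :: int
    by (simp add: hom_int_pow)
  show ?thesis
  proof unfold_locales
    fix g assume "g \<in> carrier G"
    then obtain p where p: "p \<in> carrier P" "g = h p" using surj by auto
    then obtain i :: int where "p = y [^]\<^bsub>P\<^esub> i \<or> p = x \<otimes>\<^bsub>P\<^esub> y [^]\<^bsub>P\<^esub> i" using P.carrier_cases by blast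
    then show "\<exists>i::int. g = h y [^]\<^bsub>G\<^esub> i \<or> g = h x \<otimes>\<^bsub>G\<^esub> h y [^]\<^bsub>G\<^esub> i"
      using p by (intro exI[of _ i]) (auto simp: pow)
  next
    fix i :: int
    have "h y [^]\<^bsub>G\<^esub> i = \<one>\<^bsub>G\<^esub> \<longleftrightarrow> h (y [^]\<^bsub>P\<^esub> i) = h \<one>\<^bsub>P\<^esub>" by (simp add: pow)
    also have "\<dots> \<longleftrightarrow> y [^]\<^bsub>P\<^esub> i = \<one>\<^bsub>P\<^esub>" using inj by (intro inj_on_eq_iff) auto
    finally show "h y [^]\<^bsub>G\<^esub> i = \<one>\<^bsub>G\<^esub> \<longleftrightarrow> int n dvd i" by (simp add: P.int_pow_y_eq_one)
    show "h x \<noteq> h y [^]\<^bsub>G\<^esub> i"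
      using inj P.x_neq_int_pow_y[of i] by (simp add: pow inj_on_eq_iff)
  next
    have "h (y \<otimes>\<^bsub>P\<^esub> x) = h (x \<otimes>\<^bsub>P\<^esub> inv\<^bsub>P\<^esub> y)" by (simp add: P.y_x)
    then show "h y \<otimes>\<^bsub>G\<^esub> h x = h x \<otimes>\<^bsub>G\<^esub> inv\<^bsub>G\<^esub> h y" by simp
  qed auto
qed

lemma odd_dvd_power_two_mult_iff:
  fixes d :: int
  assumes "odd m"
  shows "(\<exists>k. int (2 ^ t * m) dvd 2 ^ k * d) \<longleftrightarrow> int m dvd d"
proof
  assume "\<exists>k. int (2 ^ t * m) dvd 2 ^ k * d"
  then obtain k where "int m dvd 2 ^ k * d" by (auto dest: dvd_mult_right)
  moreover have "coprime (int m) (2 ^ k)" using assms by simp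
  ultimately show "int m dvd d" by (simp add: coprime_dvd_mult_right_iff)
next
  assume "int m dvd d"
  then have "int (2 ^ t * m) dvd 2 ^ t * d" by simp
  then show "\<exists>k. int (2 ^ t * m) dvd 2 ^ k * d" by blast
qed

section \<open>Reflections sorted by index modulo \<open>m\<close>\<close>

context dihedral_type
begin

text \<open>The index of a reflection is determined only modulo \<open>n\<close>, so
  \<open>SOME\<close> picks one; its residue modulo \<open>m\<close> is independent of the choice
  when \<open>m\<close> divides \<open>n\<close>.\<close>

definition refl_class :: "nat \<Rightarrow> 'a \<Rightarrow> nat" where
  "refl_class m v = nat ((SOME i. v = refl i) mod int m)"

lemma refl_class_refl:
  assumes "m dvd n"
  shows "refl_class m (refl i) = nat (i mod int m)"
proof -
  have "refl i = refl (SOME j. refl i = refl j)" by (rule someI[of _ i]) simp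
  then have "int n dvd i - (SOME j. refl i = refl j)" by (simp only: refl_eq_iff)
  then have "int m dvd i - (SOME j. refl i = refl j)" using assms by (meson dvd_trans int_dvd_int_iff)
  then show ?thesis unfolding refl_class_def by (simp only: mod_eq_dvd_iff[symmetric])
qed

text \<open>The class of \<open>q\<close> consists of the reflections with index
  \<open>q + k * m\<close> for \<open>k < s\<close>, which are distinct modulo
  \<open>n = s * m\<close>.\<close>

lemma card_refl_class:
  assumes n: "n = s * m" "n > 0" and q: "q < m"
  shows "card {v \<in> range refl. refl_class m v = q} = s"
proof -
  have m: "m dvd n" "m > 0" "s > 0" using n by auto
  let ?g = "\<lambda>k. refl (int q + int k * int m)"
  have "{v \<in> range refl. refl_class m v = q} = ?g ` {..<s}"
  proof (intro equalityI subsetI)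
    fix v assume "v \<in> {v \<in> range refl. refl_class m v = q}"
    then obtain i where i: "v = refl i" "refl_class m v = q" by auto
    define j where "j = i mod int n"
    have v: "v = refl j"
      unfolding i(1) refl_eq_iff j_def by (simp add: mod_eq_dvd_iff[symmetric])
    have "j mod int m = int q"
      using i(2) m(2) unfolding v refl_class_refl[OF m(1)] by auto
    then have j: "j = int q + int (nat (j div int m)) * int m"
      using m n by (simp add: j_def pos_imp_zdiv_nonneg_iff) (metis add.commute div_mult_mod_eq)
    have "int (nat (j div int m)) * int m \<le> j" using j by linarith
    also have "j < int s * int m" using n by (simp add: j_def)
    finally have "int (nat (j div int m)) < int s" by (rule mult_right_less_imp_less) simp
    then have "nat (j div int m) < s" by (simp only: of_nat_less_iff)
    moreover have "v = ?g (nat (j div int m))" using v j by (simp only:)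
    ultimately show "v \<in> ?g ` {..<s}" by blast
  next
    fix v assume "v \<in> ?g ` {..<s}"
    then show "v \<in> {v \<in> range refl. refl_class m v = q}"
      using q by (auto simp: refl_class_refl[OF m(1)])
  qed
  moreover have "inj_on ?g {..<s}"
  proof (rule inj_onI)
    fix k l assume kl: "k \<in> {..<s}" "l \<in> {..<s}" "?g k = ?g l"
    then have "int n dvd (int q + int k * int m) - (int q + int l * int m)"
      by (simp only: refl_eq_iff)
    then have "int s * int m dvd (int k - int l) * int m"
      using n by (simp add: algebra_simps)
    then have "int s dvd int k - int l" using m by simp
    then have "int k mod int s = int l mod int s" by (simp only: mod_eq_dvd_iff)
    then show "k = l" using kl by simp
  qed
  ultimately show ?thesis by (simp add: card_image)
qed

lemma balanced_multipartite_engel_graph: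
  assumes n: "n = 2 ^ t * m" and m: "odd m" "m > 1"
  shows "balanced_multipartite (engel_graph G) (refl_class m) m (2 ^ t)"
proof -
  \<comment> \<open>With \<open>d = 1\<close>: if \<open>n\<close> divided a power of two,
    \<open>m\<close> would divide 1. The Fitting subgroup computation rests on this.\<close>
  have "\<not> int n dvd 2 ^ k" for k
    using odd_dvd_power_two_mult_iff[OF m(1), of t 1] m n by auto
  then have V: "vertices (engel_graph G) = range refl" by (rule vertices_engel_graph)
  have mn: "m dvd n" and n0: "n > 0" using n m by auto
  show ?thesis
  proof
    show "simple_graph (engel_graph G)"
      using finite_range_refl[OF n0] V
      by (auto simp: simple_graph_def engel_graph_def engel_adjacent_def)
    fix v assume "v \<in> vertices (engel_graph G)"
    then show "refl_class m v < m"
      using m unfolding V by (auto simp: refl_class_refl[OF mn] nat_less_iff)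
  next
    fix q assume "q < m"
    then show "card {v \<in> vertices (engel_graph G). refl_class m v = q} = 2 ^ t"
      unfolding V by (rule card_refl_class[OF n n0])
  next
    fix u v assume uv: "u \<in> vertices (engel_graph G)" "v \<in> vertices (engel_graph G)"
    then obtain i j where ij: "u = refl i" "v = refl j" unfolding V by blast
    have "{u, v} \<in> edges (engel_graph G) \<longleftrightarrow> engel_adjacent G u v"
      using uv by (simp add: engel_graph_adjacent_iff)
    also have "\<dots> \<longleftrightarrow> \<not> int m dvd i - j"
      unfolding ij engel_adjacent_refl_iff using odd_dvd_power_two_mult_iff[OF m(1), of t "i - j"] n by blast
    also have "\<dots> \<longleftrightarrow> refl_class m u \<noteq> refl_class m v"
      using m by (simp add: ij refl_class_refl[OF mn] mod_eq_dvd_iff[symmetric] eq_nat_nat_iff)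
    finally show "{u, v} \<in> edges (engel_graph G) \<longleftrightarrow> refl_class m u \<noteq> refl_class m v" .
  qed (use m in auto)
qed

end

section \<open>The presented groups\<close>

text \<open>A pair \<open>(s, i)\<close> stands for x^s y^i, with \<open>s\<close> read as 0 or 1.
  Moving y past x inverts it, whence the test \<open>b = s\<close>; x times x contributes y^c, and
  x^-1 = x y^-c contributes y^-c.\<close>

fun letter_act :: "nat \<Rightarrow> nat \<Rightarrow> two_gens \<times> bool \<Rightarrow> bool \<times> int \<Rightarrow> bool \<times> int" where
  "letter_act n c (GenY, b) (s, i) = (s, (if b = s then i - 1 else i + 1) mod int n)"
| "letter_act n c (GenX, b) (s, i) =
     (\<not> s, (if b \<and> s then i + int c else if \<not> b \<and> \<not> s then i - int c else i) mod int n)"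

text \<open>Left multiplication of words on the normal forms \<open>x\<^sup>s y\<^sup>i\<close>, where \<open>x\<^sup>2 = y\<^sup>c\<close> and \<open>i\<close> is
  reduced modulo \<open>n\<close>.\<close>

definition word_act :: "nat \<Rightarrow> nat \<Rightarrow> two_gens word \<Rightarrow> bool \<times> int \<Rightarrow> bool \<times> int" where
  "word_act n c w = foldr (letter_act n c) w"

text \<open>One relator set for both families: \<open>c = 0\<close> is the dihedral case,
  \<open>c = 2 ^ (t - 1) * m\<close> with \<open>n = 2 ^ t * m\<close> the quaternion case.\<close>

definition dihedral_relators :: "nat \<Rightarrow> nat \<Rightarrow> (two_gens word \<times> two_gens word) set" where
  "dihedral_relators n c =
     {(wy_pow n, []), (wx @ wx, wy_pow c), (wx @ wy_pow 1 @ wx_inv, wy_inv)}"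

lemma word_act_append: "word_act n c (u @ v) = word_act n c u \<circ> word_act n c v"
  by (simp add: word_act_def fun_eq_iff)

lemma letter_act_reduced:
  "n > 0 \<Longrightarrow> snd (letter_act n c l p) \<in> {0..<int n}"
  by (cases "(n, c, l, p)" rule: letter_act.cases) auto

lemma word_act_reduced:
  "n > 0 \<Longrightarrow> snd p \<in> {0..<int n} \<Longrightarrow> snd (word_act n c w p) \<in> {0..<int n}"
  unfolding word_act_def using letter_act_reduced by (cases w) auto

lemma word_act_wy_pow:
  assumes "i \<in> {0..<int n}"
  shows "word_act n c (wy_pow k) (s, i) = (s, (if s then i - int k else i + int k) mod int n)"
proof (induction k)
  case 0
  then show ?case using assms by (simp add: word_act_def)
next
  case (Suc k)
  have "word_act n c (wy_pow (Suc k)) (s, i) = letter_act n c (GenY, True) (word_act n c (wy_pow k) (s, i))"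
    by (simp add: word_act_def)
  also have "\<dots> = (s, (if s then i - int (Suc k) else i + int (Suc k)) mod int n)"
    unfolding Suc.IH by (auto simp: mod_simps algebra_simps)
  finally show ?case .
qed

lemma letter_act_cancel:
  assumes "i \<in> {0..<int n}"
  shows "letter_act n c (g, b) (letter_act n c (g, \<not> b) (s, i)) = (s, i)"
  using assms by (cases g; cases b; cases s) (auto simp: mod_simps)

lemma word_act_relator:
  assumes n: "n dvd 2 * c" and rs: "(r, s) \<in> dihedral_relators n c" and i: "i \<in> {0..<int n}"
  shows "word_act n c r (t, i) = word_act n c s (t, i)"
proof -
  \<comment> \<open>On x y^i the word \<open>wx @ wx\<close> adds \<open>c\<close> to the exponent
    while \<open>wy_pow c\<close> subtracts it; \<open>n dvd 2 * c\<close> makes the results agree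
    modulo \<open>n\<close>.\<close>
  have "int n dvd (i + int c) - (i - int c)"
    using n by (simp add: int_dvd_int_iff[symmetric] del: int_dvd_int_iff)
  then have c: "(i + int c) mod int n = (i - int c) mod int n"
    by (simp only: mod_eq_dvd_iff)
  consider "r = wy_pow n" "s = []" | "r = wx @ wx" "s = wy_pow c"
    | "r = wx @ wy_pow 1 @ wx_inv" "s = wy_inv"
    using rs by (auto simp: dihedral_relators_def)
  then show ?thesis
  proof cases
    case 1
    then show ?thesis using i by (simp add: word_act_wy_pow) (simp add: word_act_def)
  next
    case 2
    then show ?thesis using i c by (simp add: word_act_wy_pow) (auto simp: word_act_def)
  next
    case 3
    then show ?thesis using i by (cases t) (auto simp: word_act_def mod_simps algebra_simps)
  qed
qed

text \<open>Inverse letters cancel and both sides of each relation act alike, so the action descends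
  to the presented group, where it tells elements apart.\<close>

lemma pres_eq_imp_word_act_eq:
  assumes "n > 0" "n dvd 2 * c" "pres_eq (dihedral_relators n c) u v" "snd p \<in> {0..<int n}"
  shows "word_act n c u p = word_act n c v p"
  using assms(3,4)
proof (induction arbitrary: p rule: pres_eq.induct)
  case (cancel u g b v)
  obtain s i where si: "word_act n c v p = (s, i)" by fastforce
  then have "i \<in> {0..<int n}" using word_act_reduced[OF assms(1) cancel, of c v] by simp
  then have "word_act n c [(g, b), (g, \<not> b)] (s, i) = (s, i)"
    by (simp add: word_act_def letter_act_cancel del: letter_act.simps)
  then show ?case by (simp only: word_act_append comp_apply si)
next
  case (rel r s u v)
  obtain t i where ti: "word_act n c v p = (t, i)" by fastforce
  then have "i \<in> {0..<int n}" using word_act_reduced[OF assms(1) rel.prems, of c v] by simp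
  then show ?case
    using word_act_relator[OF assms(2) rel.hyps] by (simp only: word_act_append comp_apply ti)
qed simp_all

section \<open>Normal forms in the presented groups\<close>

lemma presented_group_sel [simp]:
  "carrier (presented_group R) = range (pres_class R)"
  "\<one>\<^bsub>presented_group R\<^esub> = pres_class R []"
  by (simp_all add: presented_group_def)

lemma pres_class_pow:
  "pres_class R [l] [^]\<^bsub>presented_group R\<^esub> k = pres_class R (replicate k l)"
  by (induction k) (simp_all add: presented_group_mult replicate_append_same)

lemma pres_class_inv:
  "pres_class R [(g, False)] = inv\<^bsub>presented_group R\<^esub> pres_class R [(g, True)]"
proof -
  interpret group "presented_group R" by (rule group_presented_group)
  have "pres_class R [(g, False)] \<otimes>\<^bsub>presented_group R\<^esub> pres_class R [(g, True)] = \<one>\<^bsub>presented_group R\<^esub>"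
    using pres_eq.cancel[of R "[]" g False "[]"] by (simp add: presented_group_mult pres_class_eq_iff)
  then show ?thesis by (intro inv_equality[symmetric]) auto
qed

text \<open>The relations bring every element into the form y^i or x y^i; the action on pairs shows
  that nothing more collapses, giving the exact order of y and that x is no power of y.\<close>

lemma dihedral_type_presented_group:
  assumes n: "n > 0" and c: "n dvd 2 * c"
  defines "R \<equiv> dihedral_relators n c"
  shows "dihedral_type (presented_group R) (pres_class R wx) (pres_class R (wy_pow 1)) n"
proof -
  define P where "P = presented_group R"
  define X where "X = pres_class R wx"
  define Y where "Y = pres_class R [(GenY, True)]"
  interpret group P unfolding P_def by (rule group_presented_group)
  have X [simp]: "X \<in> carrier P" and Y [simp]: "Y \<in> carrier P"
    by (simp_all add: X_def Y_def P_def)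
  have rel: "pres_class R r = pres_class R s" if "(r, s) \<in> R" for r s
    using pres_eq.rel[OF that, of "[]" "[]"] by (simp add: pres_class_eq_iff)
  have pow: "Y [^]\<^bsub>P\<^esub> k = pres_class R (wy_pow k)" for k :: nat
    by (simp add: Y_def P_def pres_class_pow)
  have invs: "pres_class R wx_inv = inv\<^bsub>P\<^esub> X" "pres_class R wy_inv = inv\<^bsub>P\<^esub> Y"
    by (simp_all add: X_def Y_def P_def pres_class_inv)
  have Yn: "Y [^]\<^bsub>P\<^esub> n = \<one>\<^bsub>P\<^esub>"
    unfolding pow by (simp add: P_def) (rule rel, simp add: R_def dihedral_relators_def)
  have XX: "X \<otimes>\<^bsub>P\<^esub> X = Y [^]\<^bsub>P\<^esub> int c"
    unfolding int_pow_int pow unfolding X_def P_def presented_group_mult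
    by (rule rel) (simp add: R_def dihedral_relators_def)
  have XYX: "X \<otimes>\<^bsub>P\<^esub> Y \<otimes>\<^bsub>P\<^esub> inv\<^bsub>P\<^esub> X = inv\<^bsub>P\<^esub> Y"
    unfolding invs[symmetric] unfolding X_def Y_def P_def presented_group_mult
    by (rule rel) (simp add: R_def dihedral_relators_def)
  have XY: "X \<otimes>\<^bsub>P\<^esub> Y = inv\<^bsub>P\<^esub> Y \<otimes>\<^bsub>P\<^esub> X"
    unfolding XYX[symmetric] by (simp add: m_assoc)
  have YX: "Y \<otimes>\<^bsub>P\<^esub> X = X \<otimes>\<^bsub>P\<^esub> inv\<^bsub>P\<^esub> Y"
  proof -
    have "Y \<otimes>\<^bsub>P\<^esub> X = Y \<otimes>\<^bsub>P\<^esub> (X \<otimes>\<^bsub>P\<^esub> Y) \<otimes>\<^bsub>P\<^esub> inv\<^bsub>P\<^esub> Y" by (simp add: m_assoc)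
    also have "\<dots> = X \<otimes>\<^bsub>P\<^esub> inv\<^bsub>P\<^esub> Y" unfolding XY by (simp add: m_assoc[symmetric])
    finally show ?thesis .
  qed
  have invX: "inv\<^bsub>P\<^esub> X = X \<otimes>\<^bsub>P\<^esub> Y [^]\<^bsub>P\<^esub> (- int c)"
  proof -
    have "inv\<^bsub>P\<^esub> X = inv\<^bsub>P\<^esub> X \<otimes>\<^bsub>P\<^esub> (X \<otimes>\<^bsub>P\<^esub> X) \<otimes>\<^bsub>P\<^esub> Y [^]\<^bsub>P\<^esub> (- int c)"
      unfolding XX by (simp add: m_assoc int_pow_mult[symmetric])
    also have "\<dots> = X \<otimes>\<^bsub>P\<^esub> Y [^]\<^bsub>P\<^esub> (- int c)" by (simp add: m_assoc[symmetric])
    finally show ?thesis .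
  qed
  \<comment> \<open>Reducing the exponent gives a word without inverse letters, whose action is
    known.\<close>
  have pow_mod: "Y [^]\<^bsub>P\<^esub> i = pres_class R (wy_pow (nat (i mod int n)))" for i :: int
  proof -
    have "Y [^]\<^bsub>P\<^esub> i = Y [^]\<^bsub>P\<^esub> (int n * (i div int n) + i mod int n)" by simp
    also have "\<dots> = (Y [^]\<^bsub>P\<^esub> int n) [^]\<^bsub>P\<^esub> (i div int n) \<otimes>\<^bsub>P\<^esub> Y [^]\<^bsub>P\<^esub> (i mod int n)"
      by (simp only: int_pow_mult int_pow_pow Y)
    also have "\<dots> = Y [^]\<^bsub>P\<^esub> (i mod int n)"
      unfolding int_pow_int Yn by (simp add: int_pow_one)
    also have "i mod int n = int (nat (i mod int n))" using n by simp
    finally show ?thesis unfolding int_pow_int pow by simp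
  qed
  have pow_add: "Y [^]\<^bsub>P\<^esub> i \<otimes>\<^bsub>P\<^esub> Y [^]\<^bsub>P\<^esub> j = Y [^]\<^bsub>P\<^esub> (i + j)" for i j :: int
    by (simp only: int_pow_mult Y)
  \<comment> \<open>The pair \<open>(False, 0)\<close> is the normal form of the identity, so acting
    on it recovers the normal form of an element.\<close>
  have act: "word_act n c u (False, 0) = word_act n c v (False, 0)" if "pres_class R u = pres_class R v" for u v
    using that n pres_eq_imp_word_act_eq[OF n c, of u v "(False, 0)"] by (simp add: pres_class_eq_iff R_def)
  have act_pow: "word_act n c (wy_pow (nat (i mod int n))) (False, 0) = (False, i mod int n)" for i
    using n by (simp add: word_act_wy_pow)
  have "dihedral_type P X Y n"
  proof unfold_locales
    fix i :: int
    show "Y [^]\<^bsub>P\<^esub> i = \<one>\<^bsub>P\<^esub> \<longleftrightarrow> int n dvd i"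
    proof
      assume "Y [^]\<^bsub>P\<^esub> i = \<one>\<^bsub>P\<^esub>"
      then have "(False, i mod int n) = word_act n c [] (False, 0)"
        unfolding pow_mod act_pow[symmetric] by (intro act) (simp add: P_def)
      then show "int n dvd i" by (simp add: word_act_def dvd_eq_mod_eq_0)
    qed (simp only: pow_mod, simp add: P_def)
    show "X \<noteq> Y [^]\<^bsub>P\<^esub> i"
    proof
      assume "X = Y [^]\<^bsub>P\<^esub> i"
      then have "word_act n c wx (False, 0) = (False, i mod int n)"
        unfolding X_def pow_mod act_pow[symmetric] by (rule act)
      then show False by (simp add: word_act_def)
    qed
  next
    fix g assume "g \<in> carrier P"
    then obtain w where "g = pres_class R w" by (auto simp: P_def)
    moreover have "\<exists>i::int. pres_class R w = Y [^]\<^bsub>P\<^esub> i \<or> pres_class R w = X \<otimes>\<^bsub>P\<^esub> Y [^]\<^bsub>P\<^esub> i"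
    \<comment> \<open>Prepending a letter multiplies on the left by x, y or an inverse of these,
      which permutes the two shapes or preserves them.\<close>
    proof (induction w)
      case Nil
      show ?case by (rule exI[of _ 0]) (simp add: P_def)
    next
      case (Cons l w)
      then obtain i :: int where i: "pres_class R w = Y [^]\<^bsub>P\<^esub> i \<or> pres_class R w = X \<otimes>\<^bsub>P\<^esub> Y [^]\<^bsub>P\<^esub> i"
        by blast
      have lw: "pres_class R (l # w) = pres_class R [l] \<otimes>\<^bsub>P\<^esub> pres_class R w"
        by (simp add: P_def presented_group_mult)
      obtain g b where "l = (g, b)" by fastforce
      then consider "pres_class R [l] = X" | "pres_class R [l] = inv\<^bsub>P\<^esub> X"
        | "pres_class R [l] = Y [^]\<^bsub>P\<^esub> (1 :: int)" | "pres_class R [l] = Y [^]\<^bsub>P\<^esub> (- 1 :: int)"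
        using invs by (cases g; cases b) (auto simp: X_def[symmetric] Y_def[symmetric] int_pow_neg)
      then show ?case
      proof cases
        case 1
        have "X \<otimes>\<^bsub>P\<^esub> (X \<otimes>\<^bsub>P\<^esub> Y [^]\<^bsub>P\<^esub> i) = Y [^]\<^bsub>P\<^esub> (int c + i)"
          using XX by (simp add: m_assoc[symmetric] int_pow_mult)
        then show ?thesis using i unfolding lw 1 by metis
      next
        case 2
        have "inv\<^bsub>P\<^esub> X \<otimes>\<^bsub>P\<^esub> Y [^]\<^bsub>P\<^esub> i = X \<otimes>\<^bsub>P\<^esub> Y [^]\<^bsub>P\<^esub> (- int c + i)"
          unfolding invX by (simp add: m_assoc pow_add)
        moreover have "inv\<^bsub>P\<^esub> X \<otimes>\<^bsub>P\<^esub> (X \<otimes>\<^bsub>P\<^esub> Y [^]\<^bsub>P\<^esub> i) = Y [^]\<^bsub>P\<^esub> i"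
          by (simp add: m_assoc[symmetric])
        ultimately show ?thesis using i unfolding lw 2 by metis
      next
        case 3
        have "Y \<otimes>\<^bsub>P\<^esub> (X \<otimes>\<^bsub>P\<^esub> Y [^]\<^bsub>P\<^esub> i) = X \<otimes>\<^bsub>P\<^esub> (Y [^]\<^bsub>P\<^esub> (- 1 :: int) \<otimes>\<^bsub>P\<^esub> Y [^]\<^bsub>P\<^esub> i)"
          using YX by (simp add: m_assoc[symmetric] int_pow_neg)
        then have "Y [^]\<^bsub>P\<^esub> (1 :: int) \<otimes>\<^bsub>P\<^esub> (X \<otimes>\<^bsub>P\<^esub> Y [^]\<^bsub>P\<^esub> i) = X \<otimes>\<^bsub>P\<^esub> Y [^]\<^bsub>P\<^esub> (- 1 + i)"
          by (simp add: pow_add)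
        then show ?thesis using i unfolding lw 3 by (metis pow_add)
      next
        case 4
        have "inv\<^bsub>P\<^esub> Y \<otimes>\<^bsub>P\<^esub> (X \<otimes>\<^bsub>P\<^esub> Y [^]\<^bsub>P\<^esub> i) = X \<otimes>\<^bsub>P\<^esub> (Y [^]\<^bsub>P\<^esub> (1 :: int) \<otimes>\<^bsub>P\<^esub> Y [^]\<^bsub>P\<^esub> i)"
          using XY by (simp add: m_assoc[symmetric])
        then have "Y [^]\<^bsub>P\<^esub> (- 1 :: int) \<otimes>\<^bsub>P\<^esub> (X \<otimes>\<^bsub>P\<^esub> Y [^]\<^bsub>P\<^esub> i) = X \<otimes>\<^bsub>P\<^esub> Y [^]\<^bsub>P\<^esub> (1 + i)"
          by (simp only: pow_add) (simp add: int_pow_neg)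
        then show ?thesis using i unfolding lw 4 by (metis pow_add)
      qed
    qed
    ultimately show "\<exists>i::int. g = Y [^]\<^bsub>P\<^esub> i \<or> g = X \<otimes>\<^bsub>P\<^esub> Y [^]\<^bsub>P\<^esub> i" by simp
  qed (auto simp: YX)
  then show ?thesis by (simp add: P_def X_def Y_def)
qed

theorem theorem8p4:
  fixes G :: "('a, 'b) monoid_scheme" and t m :: nat
  assumes "t \<ge> 1" and "m \<ge> 3" and "odd m"
    and "group G"
    and "G \<cong> dihedral_group (2 ^ t * m) \<or> G \<cong> quaternion_group t m"
  shows "Spec (engel_graph G) =
           replicate_mset (m * (2 ^ t - 1)) 0
           + replicate_mset (m - 1) (- (2 ^ t))
           + replicate_mset 1 (2 ^ t * (real m - 1))
      \<and> L_spec (engel_graph G) =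
           replicate_mset 1 0
           + replicate_mset (m * (2 ^ t - 1)) (2 ^ t * (real m - 1))
           + replicate_mset (m - 1) (2 ^ t * real m)
      \<and> Q_spec (engel_graph G) =
           replicate_mset (m * (2 ^ t - 1)) (2 ^ t * (real m - 1))
           + replicate_mset (m - 1) (2 ^ t * (real m - 2))
           + replicate_mset 1 (2 ^ (t + 1) * (real m - 1))
      \<and> energy (engel_graph G) = 2 ^ (t + 1) * (real m - 1)
      \<and> L_energy (engel_graph G) = 2 ^ (t + 1) * (real m - 1)
      \<and> Q_energy (engel_graph G) = 2 ^ (t + 1) * (real m - 1)"
proof -
  let ?n = "2 ^ t * m"
  have n0: "?n > 0" using assms by simp
  \<comment> \<open>Subtraction on naturals is truncated, so \<open>t \<ge> 1\<close> is what makes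
    the two sides equal.\<close>
  have "2 * (2 ^ (t - 1) * m) = ?n" using \<open>t \<ge> 1\<close> by (cases t) auto
  then have c: "?n dvd 2 * (2 ^ (t - 1) * m)" by (simp only: dvd_refl)
  obtain c where c: "?n dvd 2 * c" and iso: "G \<cong> presented_group (dihedral_relators ?n c)"
    using assms(5)
  proof
    assume "G \<cong> dihedral_group ?n"
    then show thesis
      by (intro that[of 0]) (simp_all add: dihedral_group_def dihedral_relators_def)
  next
    assume "G \<cong> quaternion_group t m"
    then show thesis using c
      by (intro that[of "2 ^ (t - 1) * m"]) (simp_all add: quaternion_group_def dihedral_relators_def)
  qed
  \<comment> \<open>The isomorphism is reversed, since the generators are known in the presented
    group and have to be carried to \<open>G\<close>.\<close>
  have "presented_group (dihedral_relators ?n c) \<cong> G"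
    by (rule group.iso_sym[OF \<open>group G\<close> iso])
  then obtain h where "h \<in> iso (presented_group (dihedral_relators ?n c)) G"
    by (auto simp: is_iso_def)
  then obtain x y where "dihedral_type G x y ?n"
    using dihedral_type_iso[OF dihedral_type_presented_group[OF n0 c] _ \<open>group G\<close>] by blast
  then interpret balanced_multipartite "engel_graph G" "dihedral_type.refl_class G x y m" m "2 ^ t"
    by (rule dihedral_type.balanced_multipartite_engel_graph) (use assms in auto)
  show ?thesis
    by (simp add: Spec_eq L_spec_eq Q_spec_eq energy_eq L_energy_eq Q_energy_eq)
qed

end
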